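(* Let $G$ be a graph of order $n$ having a clique of order $k$ and a cluster $(C,S)$, where $|C|=n-k$ and $|S|=r\leq k$. For any list $\Lambda=\{\lambda_1,\lambda_2,\ldots,\lambda_n\}$ of real numbers with at least $3$ distinct elements such that at least two of these distinct elements have algebraic multiplicity greater than or equal to $2$ in $\Lambda$, there exists a matrix $M\in\mathcal{S}(G(K_{n-k}))$ with spectrum $\Lambda$.
   Context: All graphs are simple and undirected. A cluster in a graph $G$ is a pair of vertex subsets $(C,S)$, where $C$ is a maximal set of cardinality $|C|\geq 2$ of independent (pairwise non-adjacent) vertices sharing the same set $S$ of $|S|$ neighbors (i.e. every vertex of $C$ has neighborhood exactly $S$). A clique of order $k$ is a set of $k$ pairwise adjacent vertices. If $G$ has a cluster $(C,S)$ and $H$ is a graph of order $|C|$, then $G(H)$ is the graph obtained from $G$ and $H$ by identifying the vertices of $H$ with the vertices in $C$ and adding the edges of $H$ to the edges of $G$. $K_m$ is the complete graph on $m$ vertices; thus $G(K_{n-k})$ is obtained from $G$ by making all vertices of $C$ pairwise adjacent. For a graph $G$ with vertex set $\{1,\ldots,n\}$, $\mathcal{S}(G)$ is the set of real symmetric $n\times n$ matrices $A=(a_{ij})$ such that, for all $i\neq j$, $a_{ij}\neq 0$ if and only if $i$ and $j$ are adjacent in $G$ (no restriction on the diagonal). Lists are multisets; the spectrum of a matrix is the multiset of its eigenvalues counted with multiplicity; the algebraic multiplicity of an element of a list is the number of times it occurs in the list. *)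

theory Defs
  imports
    "Graph_Theory.Graph_Theory"
    "Jordan_Normal_Form.Char_Poly"
begin

text \<open>Simple undirected graphs are the finite symmetric loopless digraphs without parallel arcs
  of \<^locale>\<open>pair_graph\<close>: an edge between \<open>u\<close> and \<open>v\<close> is the pair of
  arcs \<open>(u, v)\<close> and \<open>(v, u)\<close>.\<close>

definition nbhd :: "'a pair_pre_digraph \<Rightarrow> 'a \<Rightarrow> 'a set" where
  "nbhd G v = {u \<in> pverts G. (v, u) \<in> parcs G}"

definition clique :: "'a pair_pre_digraph \<Rightarrow> 'a set \<Rightarrow> bool" where
  "clique G K \<longleftrightarrow> K \<subseteq> pverts G \<and> (\<forall>u\<in>K. \<forall>v\<in>K. u \<noteq> v \<longrightarrow> (u, v) \<in> parcs G)"

definition independent_twins :: "'a pair_pre_digraph \<Rightarrow> 'a set \<Rightarrow> 'a set \<Rightarrow> bool" where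
  "independent_twins G C S \<longleftrightarrow>
     C \<subseteq> pverts G \<and> (\<forall>u\<in>C. \<forall>v\<in>C. (u, v) \<notin> parcs G) \<and> (\<forall>v\<in>C. nbhd G v = S)"

definition cluster :: "'a pair_pre_digraph \<Rightarrow> 'a set \<Rightarrow> 'a set \<Rightarrow> bool" where
  "cluster G C S \<longleftrightarrow>
     S \<subseteq> pverts G \<and> independent_twins G C S \<and> 2 \<le> card C \<and>
     (\<forall>C'. C \<subseteq> C' \<and> independent_twins G C' S \<longrightarrow> C' = C)"

text \<open>The graph $G(H)$. The map \<open>f\<close>, meant to be a bijection from the vertices of \<open>H\<close> onto
  \<open>C\<close>, carries out the identification; \<open>C\<close> itself is then the image of \<open>f\<close>.\<close>

definition add_graph ::
  "'a pair_pre_digraph \<Rightarrow> 'b pair_pre_digraph \<Rightarrow> ('b \<Rightarrow> 'a) \<Rightarrow> 'a pair_pre_digraph" where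
  "add_graph G H f =
     \<lparr> pverts = pverts G, parcs = parcs G \<union> {(f x, f y) | x y. (x, y) \<in> parcs H} \<rparr>"

text \<open>The set $\mathcal{S}(G)$, meant for graphs with vertex set \<open>{0..<n}\<close>, since matrices
  are indexed from 0.\<close>

definition sym_mats :: "nat pair_pre_digraph \<Rightarrow> real mat set" where
  "sym_mats G =
     {A. A \<in> carrier_mat (card (pverts G)) (card (pverts G)) \<and> transpose_mat A = A \<and>
         (\<forall>i < card (pverts G). \<forall>j < card (pverts G).
            i \<noteq> j \<longrightarrow> (A $$ (i, j) \<noteq> 0 \<longleftrightarrow> (i, j) \<in> parcs G))}"

text \<open>Only the real eigenvalues are collected, with algebraic multiplicity; for a real symmetric
  matrix these are all of them.\<close>

definition eigenvalue_mset :: "real mat \<Rightarrow> real multiset" where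
  "eigenvalue_mset A = proots (char_poly A)"

end

theory Submission
  imports Defs
begin

text \<open>The graph $G(K_{n-k})$ is the union of two cliques \<open>A\<close> and \<open>B\<close> covering all vertices, because
  \<open>K\<close> and \<open>C\<close> share at most one vertex and together miss at most one. A symmetric matrix whose
  graph has a vertex \<open>v\<close> with diagonal entry different from \<open>\<mu>\<close> can be enlarged by the eigenvalue \<open>\<mu>\<close>:
  border it with \<open>\<mu>\<close> and rotate in the plane of \<open>v\<close> and the new vertex, which makes the new vertex an
  adjacent twin of \<open>v\<close>. The two twins receive different diagonal entries, so one of them can be
  split again, whatever the next eigenvalue is. It remains to find small seed matrices with a vertex
  in each nonempty twin class among \<open>A - B\<close>, \<open>A \<inter> B\<close> and \<open>B - A\<close>. If all three are nonempty, the seed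
  is a path on three vertices whose diagonal avoids the list. If \<open>A\<close> and \<open>B\<close> are disjoint, it is
  \<open>diag(a, b)\<close> for two repeated eigenvalues: the second copy of \<open>b\<close> splits the vertex carrying \<open>a\<close> and
  the second copy of \<open>a\<close> the one carrying \<open>b\<close>. For a complete graph it is a single vertex.\<close>

section \<open>Symmetric matrices with prescribed graph and characteristic polynomial\<close>

text \<open>The values \<open>E i i\<close> do not constrain \<open>M\<close>, so \<open>E\<close>
  can be taken reflexive; adjacent twins \<open>u\<close>, \<open>v\<close> then satisfy the plain
  equation \<open>E u = E v\<close>. The spectrum is kept as a factorization, which bordering and
  similarity transform directly.\<close>

definition realizes :: "(nat \<Rightarrow> nat \<Rightarrow> bool) \<Rightarrow> nat \<Rightarrow> real multiset \<Rightarrow> real mat \<Rightarrow> bool" where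
  "realizes E n \<Lambda> M \<longleftrightarrow>
     M \<in> carrier_mat n n \<and> transpose_mat M = M \<and>
     (\<forall>i<n. \<forall>j<n. i \<noteq> j \<longrightarrow> (M $$ (i, j) \<noteq> 0 \<longleftrightarrow> E i j)) \<and>
     char_poly M = (\<Prod>x\<in>#\<Lambda>. [:- x, 1:])"

lemma realizesD:
  assumes "realizes E n \<Lambda> M"
  shows "M \<in> carrier_mat n n"
    and "\<And>i j. i < n \<Longrightarrow> j < n \<Longrightarrow> M $$ (j, i) = M $$ (i, j)"
    and "\<And>i j. i < n \<Longrightarrow> j < n \<Longrightarrow> i \<noteq> j \<Longrightarrow> M $$ (i, j) \<noteq> 0 \<longleftrightarrow> E i j"
    and "char_poly M = (\<Prod>x\<in>#\<Lambda>. [:- x, 1:])"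
proof -
  show M: "M \<in> carrier_mat n n" and "char_poly M = (\<Prod>x\<in>#\<Lambda>. [:- x, 1:])"
    using assms by (auto simp: realizes_def)
  show "\<And>i j. i < n \<Longrightarrow> j < n \<Longrightarrow> i \<noteq> j \<Longrightarrow> M $$ (i, j) \<noteq> 0 \<longleftrightarrow> E i j"
    using assms by (auto simp: realizes_def)
  show "M $$ (j, i) = M $$ (i, j)" if "i < n" "j < n" for i j
    using that M assms index_transpose_mat(1)[of i M j] by (auto simp: realizes_def)
qed

lemma realizesI:
  assumes "M \<in> carrier_mat n n"
    and "\<And>i j. i < n \<Longrightarrow> j < n \<Longrightarrow> M $$ (j, i) = M $$ (i, j)"
    and "\<And>i j. i < n \<Longrightarrow> j < n \<Longrightarrow> i \<noteq> j \<Longrightarrow> M $$ (i, j) \<noteq> 0 \<longleftrightarrow> E i j"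
    and "char_poly M = (\<Prod>x\<in>#\<Lambda>. [:- x, 1:])"
  shows "realizes E n \<Lambda> M"
  using assms by (auto simp: realizes_def intro!: eq_matI)

lemma realizes_cong:
  assumes "\<And>i j. i < n \<Longrightarrow> j < n \<Longrightarrow> E i j = E' i j"
  shows "realizes E n \<Lambda> M = realizes E' n \<Lambda> M"
  using assms by (simp add: realizes_def)

lemma eigenvalue_mset_realizes:
  assumes "realizes E n \<Lambda> M"
  shows "eigenvalue_mset M = \<Lambda>"
proof -
  have "proots (\<Prod>x\<in>#\<Lambda>. [:- x, 1:]) = \<Lambda>" for \<Lambda> :: "real multiset"
  proof (induction \<Lambda>)
    case (add x \<Lambda>)
    have "(\<Prod>x\<in>#\<Lambda>. [:- x, 1:]) \<noteq> 0"
      by (auto simp: prod_mset_zero_iff)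
    then show ?case
      using add by (simp add: proots_mult del: mult_pCons_left)
  qed simp
  then show ?thesis
    by (simp add: eigenvalue_mset_def realizesD(4)[OF assms])
qed

section \<open>Bordering, similarity and relabelling\<close>

lemma char_poly_bordered:
  fixes M :: "'a :: idom mat"
  assumes M: "M \<in> carrier_mat m m"
    and N: "N = mat (Suc m) (Suc m) (\<lambda>(i, j). if i < m \<and> j < m then M $$ (i, j) else if i = j then \<mu> else 0)"
  shows "char_poly N = [:- \<mu>, 1:] * char_poly M"
proof -
  have "char_poly_matrix N =
      four_block_mat (char_poly_matrix M) (0\<^sub>m m 1) (0\<^sub>m 1 m) (mat 1 1 (\<lambda>_. [:- \<mu>, 1:]))"
    using M by (intro eq_matI) (auto simp: N char_poly_matrix_def)
  then show ?thesis
    using M by (simp add: char_poly_def det_four_block_mat_lower_left_zero[where n=m and m=1]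
        det_single[of "mat 1 1 _", simplified] mult.commute del: mult_pCons_left mult_pCons_right)
qed

text \<open>Multiplying \<open>M * P = P * N\<close> by \<open>Q\<close> on the right gives
  \<open>M = P * N * Q\<close>. The relation with one factor on each side is easier to check
  entrywise than this conjugation.\<close>

lemma char_poly_intertwined:
  fixes M :: "'a :: comm_ring_1 mat"
  assumes "M \<in> carrier_mat n n" "N \<in> carrier_mat n n" "P \<in> carrier_mat n n" "Q \<in> carrier_mat n n"
    and PQ: "P * Q = 1\<^sub>m n" and QP: "Q * P = 1\<^sub>m n" and MP: "M * P = P * N"
  shows "char_poly M = char_poly N"
proof -
  have "M = M * (P * Q)"
    using assms by simp
  also have "\<dots> = P * N * Q"
    using assms by (metis assoc_mult_mat)
  finally show ?thesis
    using assms by (intro char_poly_similar similar_matI[of _ _ P Q n]) auto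
qed

text \<open>With \<open>\<sigma>\<close> the inverse of \<open>\<pi>\<close>, the permutation matrix
  \<open>P\<close> intertwines the relabelled matrix with \<open>M\<close>: both products have the
  entries \<open>M $$ (\<sigma> i, j)\<close>.\<close>

lemma realizes_permute:
  assumes M: "realizes (\<lambda>i j. E (\<pi> i) (\<pi> j)) n \<Lambda> M" and \<pi>: "bij_betw \<pi> {..<n} {..<n}"
  shows "\<exists>M'. realizes E n \<Lambda> M'"
proof -
  define \<sigma> where "\<sigma> = inv_into {..<n} \<pi>"
  have \<sigma>: "\<sigma> i < n" "\<pi> (\<sigma> i) = i" if "i < n" for i
    using that \<pi> by (auto simp: \<sigma>_def bij_betw_inv_into_right bij_betw_def) (metis inv_into_into lessThan_iff)
  have \<pi>': "\<pi> i < n" "\<sigma> (\<pi> i) = i" if "i < n" for i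
    using that \<pi> by (auto simp: \<sigma>_def bij_betw_inv_into_left bij_betw_def)
  have inj: "\<sigma> i = \<sigma> j \<longleftrightarrow> i = j" if "i < n" "j < n" for i j
    using that \<sigma> by metis
  define M' where "M' = mat n n (\<lambda>(i, j). M $$ (\<sigma> i, \<sigma> j))"
  define P :: "real mat" where "P = mat n n (\<lambda>(i, j). if \<sigma> i = j then 1 else 0)"
  define Q :: "real mat" where "Q = mat n n (\<lambda>(i, j). if i = \<sigma> j then 1 else 0)"
  have eq: "\<sigma> i = k \<longleftrightarrow> i = \<pi> k" if "i < n" "k < n" for i k
    using that \<sigma> \<pi>' by metis
  have carr: "M \<in> carrier_mat n n" "M' \<in> carrier_mat n n" "P \<in> carrier_mat n n" "Q \<in> carrier_mat n n"
    using realizesD(1)[OF M] by (auto simp: M'_def P_def Q_def)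
  have PQ: "P * Q = 1\<^sub>m n"
    using carr
    by (intro eq_matI) (auto simp: scalar_prod_def P_def Q_def \<sigma> inj if_distrib[of "\<lambda>x. x * _"] cong: if_cong)
  then have QP: "Q * P = 1\<^sub>m n"
    using carr mat_mult_left_right_inverse by blast
  have "(M' * P) $$ (i, j) = M $$ (\<sigma> i, j)" if "i < n" "j < n" for i j
    using that carr
    by (simp add: scalar_prod_def P_def M'_def \<sigma> \<pi>' eq if_distrib[of "\<lambda>x. _ * x"] cong: if_cong)
  moreover have "(P * M) $$ (i, j) = M $$ (\<sigma> i, j)" if "i < n" "j < n" for i j
    using that carr \<sigma>
    by (simp add: scalar_prod_def P_def if_distrib[of "\<lambda>x. x * _"] cong: if_cong)
  ultimately have 2: "M' * P = P * M"
    using carr by (intro eq_matI) auto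
  have "char_poly M' = char_poly M"
    by (rule char_poly_intertwined[OF carr(2,1,3,4) PQ QP 2])
  then have "realizes E n \<Lambda> M'"
    using realizesD[OF M] \<sigma> inj by (intro realizesI) (auto simp: M'_def)
  then show ?thesis ..
qed


section \<open>Enlarging a matrix by splitting vertices into twins\<close>

text \<open>Off the diagonal, the rotation only rescales the old entries and copies a multiple of
  row \<open>v\<close> into row \<open>m\<close>, so the pattern survives. Only the entry between
  \<open>v\<close> and \<open>m\<close> could go wrong, and \<open>ne\<close> makes it
  nonzero.\<close>

lemma realizes_twin:
  assumes M: "realizes E m \<Lambda> M" and v: "v < m" and ne: "M $$ (v, v) \<noteq> \<mu>"
    and E: "symp E" "E v v" "E m = E v"
  obtains M' where "realizes E (Suc m) (add_mset \<mu> \<Lambda>) M'"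
    and "\<And>i. i < m \<Longrightarrow> i \<noteq> v \<Longrightarrow> M' $$ (i, i) = M $$ (i, i)"
    and "M' $$ (v, v) \<noteq> M' $$ (m, m)"
proof -
  \<comment> \<open>\<open>P\<close> is the rotation with cosine 3/5 and sine 4/5 in the plane of \<open>v\<close> and \<open>m\<close>; equal cosine and sine
    would make the diagonal entries at \<open>v\<close> and \<open>m\<close> coincide.\<close>
  define b where "b i = (if i = m then v else i)" for i
  define w :: "nat \<Rightarrow> real" where "w i = (if i = v then 3/5 else if i = m then 4/5 else 1)" for i
  define z :: "nat \<Rightarrow> real" where "z i = (if i = v then -4/5 else if i = m then 3/5 else 0)" for i
  define N where "N = mat (Suc m) (Suc m)
    (\<lambda>(i, j). if i < m \<and> j < m then M $$ (i, j) else if i = j then \<mu> else 0)"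
  define P where "P = mat (Suc m) (Suc m)
    (\<lambda>(i, j). w i * (if j = b i then 1 else 0) + z i * (if j = m then 1 else 0))"
  define M' where "M' = P * N * transpose_mat P"
  have b: "b i < m" "b i \<noteq> m" if "i \<le> m" for i
    using that v by (auto simp: b_def)
  \<comment> \<open>Row \<open>j\<close> of \<open>P\<close> is supported on the two distinct
    positions \<open>b j\<close> and \<open>m\<close>, so a product with \<open>P\<close> or its
    transpose has only two terms per entry.\<close>
  have sumP: "(\<Sum>l = 0..<Suc m. h l * P $$ (j, l)) = w j * h (b j) + z j * h m" if "j \<le> m" for h j
  proof -
    have "(\<Sum>l = 0..<Suc m. h l * P $$ (j, l)) =
        (\<Sum>l = 0..<Suc m. (if l = b j then w j * h (b j) else 0) + (if l = m then z j * h m else 0))"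
      using that b[OF that] by (intro sum.cong) (auto simp: P_def)
    also have "\<dots> = w j * h (b j) + z j * h m"
      using b[OF that] by (simp add: sum.distrib del: sum.atLeast0_lessThan_Suc sum.op_ivl_Suc)
    finally show ?thesis .
  qed
  have carr: "M \<in> carrier_mat m m" "N \<in> carrier_mat (Suc m) (Suc m)" "P \<in> carrier_mat (Suc m) (Suc m)"
    "transpose_mat P \<in> carrier_mat (Suc m) (Suc m)" "M' \<in> carrier_mat (Suc m) (Suc m)"
    using realizesD(1)[OF M] by (auto simp: M'_def N_def P_def)
  have mult_PT: "(X * transpose_mat P) $$ (i, j) = w j * X $$ (i, b j) + z j * X $$ (i, m)"
    if "X \<in> carrier_mat (Suc m) (Suc m)" "i \<le> m" "j \<le> m" for X i j
    using that carr sumP[of j "\<lambda>l. X $$ (i, l)"] by (simp add: scalar_prod_def)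
  have mult_P: "(P * X) $$ (i, j) = w i * X $$ (b i, j) + z i * X $$ (m, j)"
    if "X \<in> carrier_mat (Suc m) (Suc m)" "i \<le> m" "j \<le> m" for X i j
    using that carr sumP[of i "\<lambda>l. X $$ (l, j)"] by (simp add: scalar_prod_def mult.commute)
  have PPT: "P * transpose_mat P = 1\<^sub>m (Suc m)"
  proof (rule eq_matI)
    fix i j assume "i < dim_row (1\<^sub>m (Suc m) :: real mat)" "j < dim_col (1\<^sub>m (Suc m) :: real mat)"
    then have ij: "i \<le> m" "j \<le> m" by auto
    show "(P * transpose_mat P) $$ (i, j) = 1\<^sub>m (Suc m) $$ (i, j)"
      using ij b[OF ij(1)] b[OF ij(2)] v
      by (simp add: mult_PT[OF carr(3) ij]) (auto simp: P_def b_def w_def z_def)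
  qed (use carr in auto)
  then have PTP: "transpose_mat P * P = 1\<^sub>m (Suc m)"
    using carr mat_mult_left_right_inverse by blast
  have entry: "M' $$ (i, j) = w i * w j * M $$ (b i, b j) + \<mu> * z i * z j" if "i \<le> m" "j \<le> m" for i j
  proof -
    have N_entry: "N $$ (k, l) = (if k < m \<and> l < m then M $$ (k, l) else if k = l then \<mu> else 0)"
      if "k \<le> m" "l \<le> m" for k l
      using that by (simp add: N_def)
    have "P * N \<in> carrier_mat (Suc m) (Suc m)"
      using carr by simp
    then have "M' $$ (i, j) = w j * (P * N) $$ (i, b j) + z j * (P * N) $$ (i, m)"
      unfolding M'_def using that by (rule mult_PT)
    then show ?thesis
      using that b[OF that(1)] b[OF that(2)]
      by (simp add: mult_P[OF carr(2)] N_entry algebra_simps)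
  qed
  have "char_poly M' = char_poly N"
    using carr PPT PTP by (intro char_poly_similar similar_matI[of _ _ P "transpose_mat P" "Suc m"]) (auto simp: M'_def)
  also have "\<dots> = (\<Prod>x\<in>#add_mset \<mu> \<Lambda>. [:- x, 1:])"
    by (simp add: char_poly_bordered[OF carr(1) N_def] realizesD(4)[OF M] del: mult_pCons_left)
  finally have cp: "char_poly M' = (\<Prod>x\<in>#add_mset \<mu> \<Lambda>. [:- x, 1:])" .
  have sym: "M' $$ (j, i) = M' $$ (i, j)" if "i \<le> m" "j \<le> m" for i j
    using that realizesD(2)[OF M] b by (simp add: entry)
  \<comment> \<open>The entry at \<open>(v, m)\<close> is 12/25 times
    \<open>M $$ (v, v) - \<mu>\<close>. Every other entry above the diagonal is a nonzero multiple
    of an entry of \<open>M\<close>, since \<open>z\<close> vanishes outside \<open>v\<close> and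
    \<open>m\<close>.\<close>
  have up: "M' $$ (i, j) \<noteq> 0 \<longleftrightarrow> E i j" if "i < j" "j \<le> m" for i j
  proof (cases "j = m")
    case True
    show ?thesis
    proof (cases "i = v")
      case True
      moreover have "E v m"
        using E by (metis sympD)
      ultimately show ?thesis
        using \<open>j = m\<close> v ne by (simp add: entry b_def w_def z_def)
    next
      case False
      have "E i m \<longleftrightarrow> E i v"
        using E by (metis sympD)
      with \<open>j = m\<close> False that v realizesD(3)[OF M, of i v] show ?thesis
        by (auto simp: entry b_def w_def z_def)
    qed
  next
    case False
    with that v realizesD(3)[OF M, of i j] show ?thesis
      by (auto simp: entry b_def w_def z_def)
  qed
  show ?thesis
  proof
    show "realizes E (Suc m) (add_mset \<mu> \<Lambda>) M'"
    proof (rule realizesI[OF carr(5) _ _ cp])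
      fix i j assume "i < Suc m" "j < Suc m" "i \<noteq> j"
      then consider "i < j" "j \<le> m" | "j < i" "i \<le> m" by linarith
      then show "M' $$ (i, j) \<noteq> 0 \<longleftrightarrow> E i j"
      proof cases
        case 2
        then show ?thesis using up[of j i] sym[of j i] E(1) by (metis less_imp_le order.trans sympD)
      qed (rule up)
    qed (simp add: sym)
    show "M' $$ (i, i) = M $$ (i, i)" if "i < m" "i \<noteq> v" for i
      using that by (simp add: entry b_def w_def z_def)
    \<comment> \<open>The two diagonal entries differ by 7/25 of the gap between
      \<open>M $$ (v, v)\<close> and \<open>\<mu>\<close>.\<close>
    show "M' $$ (v, v) \<noteq> M' $$ (m, m)"
      using v ne by (simp add: entry b_def w_def z_def)
  qed
qed

text \<open>The fourth assumption is the invariant of the induction: each vertex still to come has a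
  placed twin that can be split by any value in \<open>T\<close>. The set \<open>T\<close> stays
  fixed while the list shrinks.\<close>

lemma realizes_extend:
  assumes "realizes E m \<Lambda> M" and "symp E" and "\<And>i. i < n \<Longrightarrow> E i i"
    and "\<And>u \<mu>. m \<le> u \<Longrightarrow> u < n \<Longrightarrow> \<mu> \<in> T \<Longrightarrow> \<exists>v<m. E u = E v \<and> M $$ (v, v) \<noteq> \<mu>"
    and "set_mset \<Lambda>' \<subseteq> T" and "m + size \<Lambda>' = n"
  shows "\<exists>M'. realizes E n (\<Lambda> + \<Lambda>') M'"
  using assms
proof (induction \<Lambda>' arbitrary: \<Lambda> m M)
  case empty
  then show ?case by auto
next
  case (add \<mu> \<Lambda>')
  from add.prems(6) have "m < n" by simp
  with add.prems(4)[of m \<mu>] add.prems(5) obtain v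
    where v: "v < m" "E m = E v" "M $$ (v, v) \<noteq> \<mu>" by auto
  with \<open>m < n\<close> add.prems(3) have "E v v" by simp
  with v obtain M' where M': "realizes E (Suc m) (add_mset \<mu> \<Lambda>) M'"
    and diag: "\<And>i. i < m \<Longrightarrow> i \<noteq> v \<Longrightarrow> M' $$ (i, i) = M $$ (i, i)"
    and ne: "M' $$ (v, v) \<noteq> M' $$ (m, m)"
    using realizes_twin[OF add.prems(1) v(1,3) add.prems(2)] by metis
  have "\<exists>M''. realizes E n (add_mset \<mu> \<Lambda> + \<Lambda>') M''"
  proof (rule add.IH[OF M' add.prems(2,3)])
    fix u \<nu> assume u: "Suc m \<le> u" "u < n" "\<nu> \<in> T"
    then obtain v' where v': "v' < m" "E u = E v'" "M $$ (v', v') \<noteq> \<nu>"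
      using add.prems(4)[of u \<nu>] by auto
    show "\<exists>v<Suc m. E u = E v \<and> M' $$ (v, v) \<noteq> \<nu>"
    proof (cases "v' = v")
      case True
      \<comment> \<open>If the usable twin of \<open>u\<close> was the vertex just split, then
        \<open>v\<close> and \<open>m\<close> are now both twins of \<open>u\<close>, and their
        distinct diagonal entries cannot both equal \<open>\<nu>\<close>.\<close>
      from ne consider "M' $$ (v, v) \<noteq> \<nu>" | "M' $$ (m, m) \<noteq> \<nu>" by metis
      then show ?thesis
        using v v' True by cases (metis less_Suc_eq, metis lessI)
    next
      case False
      with v' diag show ?thesis by (metis less_Suc_eq)
    qed
  qed (use add.prems in auto)
  then show ?case by simp
qed

text \<open>Lets the seed sit on arbitrary vertices \<open>xs\<close>: extension requires it on the
  first indices, and a permutation then restores the original labels.\<close>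

lemma realizes_from_seed:
  assumes M: "realizes (\<lambda>i j. E (xs ! i) (xs ! j)) (length xs) \<Lambda> M"
    and xs: "distinct xs" "set xs \<subseteq> {..<n}"
    and E: "symp E" "\<And>i. i < n \<Longrightarrow> E i i"
    and diag: "\<And>u \<mu>. u < n \<Longrightarrow> u \<notin> set xs \<Longrightarrow> \<mu> \<in> T \<Longrightarrow>
        \<exists>i<length xs. E u = E (xs ! i) \<and> M $$ (i, i) \<noteq> \<mu>"
    and \<Lambda>': "set_mset \<Lambda>' \<subseteq> T" "length xs + size \<Lambda>' = n"
  shows "\<exists>M'. realizes E n (\<Lambda> + \<Lambda>') M'"
proof -
  \<comment> \<open>Listing the seed first makes the indices from \<open>length xs\<close> on
    exactly the vertices to be added.\<close>
  define ys where "ys = xs @ sorted_list_of_set ({..<n} - set xs)"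
  have ys: "distinct ys" "set ys = {..<n}"
    using xs by (auto simp: ys_def)
  then have len: "length ys = n"
    using distinct_card by fastforce
  then have bij: "bij_betw (\<lambda>i. ys ! i) {..<n} {..<n}"
    using bij_betw_nth[OF ys(1)] ys(2) by simp
  have ys_lt: "ys ! i < n" if "i < n" for i
    using that ys(2) len nth_mem by blast
  have ys_xs: "ys ! i = xs ! i" if "i < length xs" for i
    using that by (simp add: ys_def nth_append)
  have "\<exists>M'. realizes (\<lambda>i j. E (ys ! i) (ys ! j)) n (\<Lambda> + \<Lambda>') M'"
  proof (rule realizes_extend[OF _ _ _ _ \<Lambda>'])
    show "realizes (\<lambda>i j. E (ys ! i) (ys ! j)) (length xs) \<Lambda> M"
      using M by (subst realizes_cong) (auto simp: ys_xs)
    show "symp (\<lambda>i j. E (ys ! i) (ys ! j))"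
      using E(1) by (auto simp: symp_def)
    show "E (ys ! i) (ys ! i)" if "i < n" for i
      using E(2) ys_lt that by simp
    fix u \<mu> assume u: "length xs \<le> u" "u < n" "\<mu> \<in> T"
    have "ys ! u \<notin> set xs"
      using u len xs nth_mem[of "u - length xs" "sorted_list_of_set ({..<n} - set xs)"]
      by (auto simp: ys_def nth_append)
    then show "\<exists>v<length xs. (\<lambda>j. E (ys ! u) (ys ! j)) = (\<lambda>j. E (ys ! v) (ys ! j)) \<and> M $$ (v, v) \<noteq> \<mu>"
      using diag[OF ys_lt[OF u(2)] _ u(3)] ys_xs by metis
  qed
  then show ?thesis
    using realizes_permute[OF _ bij] by auto
qed

section \<open>Small seed matrices and the complete graph\<close>

lemma det_3:
  fixes A :: "'a :: comm_ring_1 mat"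
  assumes "A \<in> carrier_mat 3 3"
  shows "det A = A $$ (0, 0) * (A $$ (1, 1) * A $$ (2, 2) - A $$ (1, 2) * A $$ (2, 1))
    - A $$ (1, 0) * (A $$ (0, 1) * A $$ (2, 2) - A $$ (0, 2) * A $$ (2, 1))
    + A $$ (2, 0) * (A $$ (0, 1) * A $$ (1, 2) - A $$ (0, 2) * A $$ (1, 1))"
proof -
  have det_2: "det B = B $$ (0, 0) * B $$ (1, 1) - B $$ (1, 0) * B $$ (0, 1)"
    if "B \<in> carrier_mat 2 2" for B :: "'a mat"
    using that by (subst laplace_expansion_column[of B 2 0])
      (auto simp: cofactor_def mat_delete_def det_single[where A = "mat 1 1 _", simplified] numeral_2_eq_2)
  show ?thesis
    using assms by (subst laplace_expansion_column[of A 3 0])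
      (auto simp: cofactor_def mat_delete_def det_2 numeral_3_eq_3 numeral_2_eq_2 algebra_simps)
qed

text \<open>An inverse eigenvalue problem for a tridiagonal matrix. The end diagonal entries range
  over open intervals, so finitely many values can be avoided; the trace then fixes the middle
  one.\<close>

lemma realizes_path_3:
  fixes x y z :: real
  assumes xyz: "x < y" "y < z" and T: "finite T"
  obtains M where "realizes (\<lambda>i j. \<not> (i = 0 \<and> j = 2) \<and> \<not> (i = 2 \<and> j = 0)) 3 {#x, y, z#} M"
    and "\<And>i. i < 3 \<Longrightarrow> M $$ (i, i) \<notin> T"
proof -
  have avoid: "\<exists>c. a < c \<and> c < b \<and> c \<notin> U" if "a < b" "finite U" for a b :: real and U
    using that infinite_Ioo[of a b] by (meson finite_subset greaterThanLessThan_iff subsetI)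
  obtain \<alpha> where \<alpha>: "y < \<alpha>" "\<alpha> < z" "\<alpha> \<notin> T"
    using avoid xyz T by blast
  \<comment> \<open>The second forbidden set keeps the middle entry \<open>\<beta>\<close>,
    determined by the trace, out of \<open>T\<close>.\<close>
  obtain \<gamma> where \<gamma>: "x < \<gamma>" "\<gamma> < y" "\<gamma> \<notin> T \<union> (\<lambda>t. x + y + z - \<alpha> - t) ` T"
    using avoid xyz T by (metis finite_Un finite_imageI)
  define \<beta> where "\<beta> = x + y + z - \<alpha> - \<gamma>"
  have \<beta>: "\<beta> \<notin> T"
  proof
    assume "\<beta> \<in> T"
    then have "x + y + z - \<alpha> - \<beta> \<in> (\<lambda>t. x + y + z - \<alpha> - t) ` T" by blast
    with \<gamma>(3) show False by (simp add: \<beta>_def)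
  qed
  \<comment> \<open>\<open>r\<^sup>2\<close> and \<open>s\<^sup>2\<close> below are forced: with diagonal \<open>\<alpha>, \<beta>, \<gamma>\<close> the characteristic polynomial takes the
    values \<open>- r\<^sup>2 (\<alpha> - \<gamma>)\<close> at \<open>\<alpha>\<close> and \<open>s\<^sup>2 (\<alpha> - \<gamma>)\<close> at \<open>\<gamma>\<close>.\<close>
  define p where "p t = (t - x) * (t - y) * (t - z)" for t
  \<comment> \<open>The cubic \<open>p\<close> is negative between \<open>y\<close> and
    \<open>z\<close> and positive between \<open>x\<close> and \<open>y\<close>; this makes both
    prescribed squares positive.\<close>
  have p_sign: "p \<alpha> < 0" "0 < p \<gamma>"
    unfolding p_def using \<alpha> \<gamma> xyz by (simp_all add: mult_pos_neg mult_neg_neg)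
  then have pos: "0 < - p \<alpha> / (\<alpha> - \<gamma>)" "0 < p \<gamma> / (\<alpha> - \<gamma>)"
    using \<alpha> \<gamma> by (simp_all add: divide_neg_pos)
  define r where "r = sqrt (- p \<alpha> / (\<alpha> - \<gamma>))"
  define s where "s = sqrt (p \<gamma> / (\<alpha> - \<gamma>))"
  have rs: "r \<noteq> 0" "s \<noteq> 0" "r * r * (\<alpha> - \<gamma>) = - p \<alpha>" "s * s * (\<alpha> - \<gamma>) = p \<gamma>"
    using pos p_sign \<alpha> \<gamma> by (auto simp: r_def s_def)
  define M where "M = mat 3 3 (\<lambda>(i, j). [[\<alpha>, r, 0], [r, \<beta>, s], [0, s, \<gamma>]] ! i ! j)"
  have M: "M \<in> carrier_mat 3 3"
    by (simp add: M_def)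
  have M_entry: "M $$ (0, 0) = \<alpha>" "M $$ (0, Suc 0) = r" "M $$ (0, 2) = 0" "M $$ (Suc 0, 0) = r"
    "M $$ (Suc 0, Suc 0) = \<beta>" "M $$ (Suc 0, 2) = s" "M $$ (2, 0) = 0" "M $$ (2, Suc 0) = s"
    "M $$ (2, 2) = \<gamma>"
    by (simp_all add: M_def)
  have less_3: "i < 3 \<longleftrightarrow> i = 0 \<or> i = Suc 0 \<or> i = 2" for i :: nat
    by auto
  have ne: "\<alpha> - \<gamma> \<noteq> 0" using \<alpha> \<gamma> by simp
  \<comment> \<open>Multiplied by \<open>\<alpha> - \<gamma>\<close>, the squares of
    \<open>r\<close> and \<open>s\<close> become values of \<open>p\<close>, which leaves a
    polynomial identity. The same device proves \<open>e3\<close>.\<close>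
  have e2: "\<alpha> * \<beta> + \<alpha> * \<gamma> + \<beta> * \<gamma> - r * r - s * s = x * y + x * z + y * z" (is "?l = ?r")
  proof -
    have "(\<alpha> - \<gamma>) * ?l = (\<alpha> - \<gamma>) * (\<alpha> * \<beta> + \<alpha> * \<gamma> + \<beta> * \<gamma>)
        - r * r * (\<alpha> - \<gamma>) - s * s * (\<alpha> - \<gamma>)"
      by (simp add: algebra_simps)
    also have "\<dots> = (\<alpha> - \<gamma>) * ?r"
      unfolding rs p_def \<beta>_def by (simp add: algebra_simps)
    finally show ?thesis using ne by simp
  qed
  have e3: "\<alpha> * \<beta> * \<gamma> - \<alpha> * (s * s) - \<gamma> * (r * r) = x * y * z" (is "?l = ?r")
  proof -
    have "(\<alpha> - \<gamma>) * ?l = (\<alpha> - \<gamma>) * (\<alpha> * \<beta> * \<gamma>)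
        - \<alpha> * (s * s * (\<alpha> - \<gamma>)) - \<gamma> * (r * r * (\<alpha> - \<gamma>))"
      by (simp add: algebra_simps)
    also have "\<dots> = (\<alpha> - \<gamma>) * ?r"
      unfolding rs p_def \<beta>_def by (simp add: algebra_simps)
    finally show ?thesis using ne by simp
  qed
  have "char_poly M = [:- (\<alpha> * \<beta> * \<gamma> - \<alpha> * (s * s) - \<gamma> * (r * r)),
      \<alpha> * \<beta> + \<alpha> * \<gamma> + \<beta> * \<gamma> - r * r - s * s, - (\<alpha> + \<beta> + \<gamma>), 1:]"
    using M by (simp add: char_poly_def det_3 char_poly_matrix_def M_entry algebra_simps)
  also have "\<dots> = (\<Prod>t\<in>#{#x, y, z#}. [:- t, 1:])"
    unfolding e2 e3 by (simp add: \<beta>_def algebra_simps)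
  finally have "realizes (\<lambda>i j. \<not> (i = 0 \<and> j = 2) \<and> \<not> (i = 2 \<and> j = 0)) 3 {#x, y, z#} M"
    using rs(1,2) by (intro realizesI[OF M]) (auto simp: less_3 M_entry)
  moreover have "M $$ (i, i) \<notin> T" if "i < 3" for i
    using that \<alpha>(3) \<beta> \<gamma>(3) by (auto simp: less_3 M_entry)
  ultimately show ?thesis
    using that by blast
qed

lemma realizes_diag_2:
  assumes "\<not> E 0 1" "\<not> E 1 0"
  obtains M where "realizes E 2 {#a, b#} M" "M $$ (0, 0) = a" "M $$ (1, 1) = b"
proof
  let ?M = "mat 2 2 (\<lambda>(i, j). if i = j then if i = 0 then a else b else 0)"
  have "char_poly ?M = (\<Prod>x\<leftarrow>diag_mat ?M. [:- x, 1:])"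
    by (rule char_poly_upper_triangular[of _ 2]) auto
  then show "realizes E 2 {#a, b#} ?M"
    using assms by (intro realizesI) (auto simp: diag_mat_def numeral_2_eq_2 less_Suc_eq)
qed auto

text \<open>All vertices are twins. Splitting the single vertex with entry \<open>a\<close> by
  \<open>b\<close> gives two unequal diagonal entries, and one of them differs from any given
  further eigenvalue.\<close>

lemma realizes_complete:
  assumes "a \<noteq> b" and n: "size \<Lambda> + 2 = n" and E: "\<And>i j. i < n \<Longrightarrow> j < n \<Longrightarrow> E i j"
  shows "\<exists>M. realizes E n ({#a, b#} + \<Lambda>) M"
proof -
  let ?E = "\<lambda>_ _ :: nat. True"
  have M0: "realizes ?E 1 {#a#} (mat 1 1 (\<lambda>_. a))"
  proof (rule realizesI)
    have "char_poly (mat 1 1 (\<lambda>_. a)) = (\<Prod>x\<leftarrow>diag_mat (mat 1 1 (\<lambda>_. a)). [:- x, 1:])"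
      by (rule char_poly_upper_triangular[of _ 1]) auto
    then show "char_poly (mat 1 1 (\<lambda>_. a)) = (\<Prod>x\<in>#{#a#}. [:- x, 1:])"
      by (simp add: diag_mat_def)
  qed auto
  have "symp ?E"
    by (simp add: symp_def)
  then obtain M where M: "realizes ?E (Suc 1) (add_mset b {#a#}) M" "M $$ (0, 0) \<noteq> M $$ (1, 1)"
    using realizes_twin[OF M0, of 0 b] assms(1) by (simp, metis)
  have "\<exists>M. realizes ?E n (add_mset b {#a#} + \<Lambda>) M"
  proof (rule realizes_extend[OF M(1), where T = UNIV])
    show "\<exists>v<Suc 1. ?E u = ?E v \<and> M $$ (v, v) \<noteq> \<mu>" for u \<mu>
      using M(2) by (metis lessI zero_less_Suc)
  qed (use n in \<open>simp_all add: symp_def\<close>)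
  moreover have "realizes ?E n \<Lambda>' M \<longleftrightarrow> realizes E n \<Lambda>' M" for \<Lambda>' M
    using E by (intro realizes_cong) auto
  ultimately show ?thesis
    by (simp add: add_mset_commute)
qed


section \<open>Unions of two cliques\<close>

text \<open>Reflexive on the union of \<open>A\<close> and \<open>B\<close>, so that membership in
  the same sets gives equal rows. The two sets may overlap.\<close>

definition two_cliques :: "'a set \<Rightarrow> 'a set \<Rightarrow> 'a \<Rightarrow> 'a \<Rightarrow> bool" where
  "two_cliques A B i j \<longleftrightarrow> i \<in> A \<and> j \<in> A \<or> i \<in> B \<and> j \<in> B"

lemma two_cliques_eqI: "(u \<in> A \<longleftrightarrow> v \<in> A) \<Longrightarrow> (u \<in> B \<longleftrightarrow> v \<in> B) \<Longrightarrow> two_cliques A B u = two_cliques A B v"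
  by (simp add: two_cliques_def fun_eq_iff)

lemma symp_two_cliques: "symp (two_cliques A B)"
  by (auto simp: symp_def two_cliques_def)

lemma realizes_disjoint_cliques:
  assumes AB: "A \<union> B = {..<n}" "A \<inter> B = {}" "A \<noteq> {}" "2 \<le> card B" and "a \<noteq> b"
    and n: "size \<Lambda> + 4 = n"
  shows "\<exists>M. realizes (two_cliques A B) n ({#a, a, b, b#} + \<Lambda>) M"
    (is "\<exists>M. realizes ?E n _ M")
proof -
  have refl: "?E i i" if "i < n" for i
    using that AB(1) by (auto simp: two_cliques_def)
  obtain y0 y1 where y: "y0 \<in> B" "y1 \<in> B" "y0 \<noteq> y1"
    using AB(4) by (meson card_2_iff' obtain_subset_with_card_n subsetD)
  show ?thesis
  proof (cases "\<exists>w. A = {w}")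
    case True
    then obtain w where A: "A = {w}" by blast
    let ?xs = "[w, y0, y1]"
    define F where "F i j = ?E (?xs ! i) (?xs ! j)" for i j
    have F: "symp F" "F 1 1" "F 2 = F 1" "\<not> F 0 1" "\<not> F 1 0"
      using AB(2) A y by (auto simp: F_def symp_def two_cliques_def)
    obtain M0 where M0: "realizes F 2 {#a, b#} M0" "M0 $$ (1, 1) = b"
      using realizes_diag_2[of F a b] F(4,5) by metis
    then obtain M where M: "realizes F (Suc 2) (add_mset a {#a, b#}) M" "M $$ (1, 1) \<noteq> M $$ (2, 2)"
      using realizes_twin[OF M0(1) _ _ F(1,2,3), of a] \<open>a \<noteq> b\<close> by (metis one_less_numeral_iff semiring_norm(76))
    \<comment> \<open>The only vertex of \<open>A\<close> needs no twin, so the second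
      \<open>b\<close> joins the eigenvalues to be split off inside \<open>B\<close>.\<close>
    have "\<exists>M. realizes ?E n ({#a, a, b#} + add_mset b \<Lambda>) M"
    proof (rule realizes_from_seed[where xs = ?xs and M = M and T = UNIV])
      show "realizes (\<lambda>i j. ?E (?xs ! i) (?xs ! j)) (length ?xs) {#a, a, b#} M"
        using M(1) by (simp add: F_def[abs_def] numeral_3_eq_3 numeral_2_eq_2)
      show "\<exists>i<length ?xs. ?E u = ?E (?xs ! i) \<and> M $$ (i, i) \<noteq> \<mu>" if "u < n" "u \<notin> set ?xs" for u \<mu>
      proof -
        have "u \<in> B" "u \<notin> A"
          using that AB A by auto
        then have "?E u = ?E (?xs ! 1)" "?E u = ?E (?xs ! 2)"
          using y AB(2) by (auto intro!: two_cliques_eqI)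
        moreover have "M $$ (1, 1) \<noteq> \<mu> \<or> M $$ (2, 2) \<noteq> \<mu>"
          using M(2) by metis
        moreover have "1 < length ?xs" "2 < length ?xs" by simp_all
        ultimately show ?thesis by metis
      qed
    qed (use AB A y n symp_two_cliques refl in auto)
    then show ?thesis
      by (simp add: ac_simps)
  next
    case False
    then obtain x0 x1 where x: "x0 \<in> A" "x1 \<in> A" "x0 \<noteq> x1"
      using AB(3) by blast
    \<comment> \<open>Each split appends its new vertex: index 2 becomes the twin of 0, and index 3
      the twin of 1.\<close>
    let ?xs = "[x0, y0, x1, y1]"
    define F where "F i j = ?E (?xs ! i) (?xs ! j)" for i j
    have F: "symp F" "\<not> F 0 1" "\<not> F 1 0" "F 0 0" "F 2 = F 0" "F 1 1" "F (Suc 2) = F 1"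
      using AB(2) x y by (auto simp: F_def symp_def two_cliques_def fun_eq_iff)
    have less: "0 < (2::nat)" "1 < (2::nat)" "1 < Suc 2" "0 < Suc 2" "2 < Suc 2" "1 \<noteq> (0::nat)" "2 \<noteq> (1::nat)"
      by simp_all
    obtain M0 where M0: "realizes F 2 {#a, b#} M0" "M0 $$ (0, 0) = a" "M0 $$ (1, 1) = b"
      using realizes_diag_2[of F a b] F(2,3) by metis
    then obtain M1 where M1: "realizes F (Suc 2) (add_mset b {#a, b#}) M1"
        "M1 $$ (0, 0) \<noteq> M1 $$ (2, 2)" "M1 $$ (1, 1) = b"
      using realizes_twin[OF M0(1) _ _ F(1,4,5), of b] \<open>a \<noteq> b\<close> less by metis
    \<comment> \<open>The first split left the diagonal entry at 1 equal to \<open>b\<close>, so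
      \<open>a\<close> can split it; this split in turn leaves the entries at 0 and 2
      distinct.\<close>
    then obtain M where M: "realizes F (Suc (Suc 2)) (add_mset a (add_mset b {#a, b#})) M"
        "M $$ (1, 1) \<noteq> M $$ (Suc 2, Suc 2)" "M $$ (0, 0) \<noteq> M $$ (2, 2)"
      using realizes_twin[OF M1(1) _ _ F(1,6,7), of a] \<open>a \<noteq> b\<close> less by metis
    have "\<exists>M. realizes ?E n ({#a, b, a, b#} + \<Lambda>) M"
    proof (rule realizes_from_seed[where xs = ?xs and M = M and T = UNIV])
      show "realizes (\<lambda>i j. ?E (?xs ! i) (?xs ! j)) (length ?xs) {#a, b, a, b#} M"
        using M(1) by (simp add: F_def[abs_def] numeral_3_eq_3 numeral_2_eq_2)
      show "\<exists>i<length ?xs. ?E u = ?E (?xs ! i) \<and> M $$ (i, i) \<noteq> \<mu>" if "u < n" "u \<notin> set ?xs" for u \<mu>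
      proof (cases "u \<in> A")
        case True
        then have "?E u = ?E (?xs ! 0)" "?E u = ?E (?xs ! 2)"
          using x AB(2) by (auto intro!: two_cliques_eqI)
        moreover have "M $$ (0, 0) \<noteq> \<mu> \<or> M $$ (2, 2) \<noteq> \<mu>"
          using M(3) by metis
        moreover have "0 < length ?xs" "2 < length ?xs" by simp_all
        ultimately show ?thesis by metis
      next
        case False
        with that AB have "u \<in> B" by auto
        with False have "?E u = ?E (?xs ! 1)" "?E u = ?E (?xs ! 3)"
          using y AB(2) by (auto intro!: two_cliques_eqI)
        moreover have "M $$ (1, 1) \<noteq> \<mu> \<or> M $$ (3, 3) \<noteq> \<mu>"
          using M(2) by (metis eval_nat_numeral(3) numeral_3_eq_3 numeral_2_eq_2)
        moreover have "1 < length ?xs" "3 < length ?xs" by simp_all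
        ultimately show ?thesis by metis
      qed
    qed (use AB x y n symp_two_cliques refl in auto)
    then show ?thesis
      by (simp add: add_mset_commute[of b a])
  qed
qed

lemma realizes_overlapping_cliques:
  fixes x y z :: real
  assumes AB: "A \<union> B = {..<n}" "A - B \<noteq> {}" "A \<inter> B \<noteq> {}" "B - A \<noteq> {}"
    and xyz: "x < y" "y < z" and n: "size \<Lambda> + 3 = n"
  shows "\<exists>M. realizes (two_cliques A B) n ({#x, y, z#} + \<Lambda>) M"
    (is "\<exists>M. realizes ?E n _ M")
proof -
  obtain p q s where pqs: "p \<in> A" "p \<notin> B" "q \<in> A" "q \<in> B" "s \<in> B" "s \<notin> A"
    using AB by blast
  obtain M where M: "realizes (\<lambda>i j. \<not> (i = 0 \<and> j = 2) \<and> \<not> (i = 2 \<and> j = 0)) 3 {#x, y, z#} M"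
    and diag: "\<And>i. i < 3 \<Longrightarrow> M $$ (i, i) \<notin> set_mset \<Lambda>"
    using realizes_path_3[OF xyz, of "set_mset \<Lambda>"] by auto
  let ?xs = "[p, q, s]"
  show ?thesis
  \<comment> \<open>Each class has just one seed vertex, whose diagonal entry cannot differ from
    every real number; hence \<open>T\<close> is only the set of remaining eigenvalues.\<close>
  proof (rule realizes_from_seed[where xs = ?xs and M = M and T = "set_mset \<Lambda>"])
    show "realizes (\<lambda>i j. ?E (?xs ! i) (?xs ! j)) (length ?xs) {#x, y, z#} M"
    proof (subst realizes_cong)
      show "?E (?xs ! i) (?xs ! j) \<longleftrightarrow> \<not> (i = 0 \<and> j = 2) \<and> \<not> (i = 2 \<and> j = 0)"
        if "i < length ?xs" "j < length ?xs" for i j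
        using that pqs by (auto simp: less_Suc_eq numeral_2_eq_2 two_cliques_def)
    qed (use M in \<open>simp add: numeral_3_eq_3\<close>)
    show "\<exists>i<length ?xs. ?E u = ?E (?xs ! i) \<and> M $$ (i, i) \<noteq> \<mu>"
      if "u < n" "\<mu> \<in> set_mset \<Lambda>" for u \<mu>
    proof -
      have "M $$ (i, i) \<noteq> \<mu>" if "i < length ?xs" for i
        using diag[of i] that \<open>\<mu> \<in> set_mset \<Lambda>\<close> by auto
      moreover have "u \<in> A \<or> u \<in> B"
        using that AB(1) by auto
      then have "?E u = ?E (?xs ! 0) \<or> ?E u = ?E (?xs ! 1) \<or> ?E u = ?E (?xs ! 2)"
        using pqs by (cases "u \<in> A"; cases "u \<in> B") (simp_all add: two_cliques_def fun_eq_iff)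
      moreover have "0 < length ?xs" "1 < length ?xs" "2 < length ?xs" by simp_all
      ultimately show ?thesis by metis
    qed
  qed (use AB(1) pqs n symp_two_cliques in \<open>auto simp: two_cliques_def\<close>)
qed


text \<open>The repeated values \<open>a\<close> and \<open>b\<close> serve disjoint cliques, three
  distinct values serve properly overlapping ones, and if one clique covers everything the graph is
  complete.\<close>

lemma realizes_two_cliques:
  assumes AB: "A \<union> B = {..<n}" and n: "size \<Lambda> = n"
    and three: "3 \<le> card (set_mset \<Lambda>)" and two: "2 \<le> card {x \<in> set_mset \<Lambda>. 2 \<le> count \<Lambda> x}"
  shows "\<exists>M. realizes (two_cliques A B) n \<Lambda> M"
proof -
  obtain a b where ab: "a \<noteq> b" "2 \<le> count \<Lambda> a" "2 \<le> count \<Lambda> b"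
    using two by (auto elim!: obtain_subset_with_card_n simp: card_2_iff)
  then have "{#a, a, b, b#} \<subseteq># \<Lambda>"
    by (auto simp: subseteq_mset_def)
  then obtain \<Lambda>' where \<Lambda>': "\<Lambda> = {#a, a, b, b#} + \<Lambda>'"
    by (metis subset_mset.add_diff_inverse)
  consider "A = {..<n} \<or> B = {..<n}" | "A \<inter> B = {}" "A \<noteq> {}" "B \<noteq> {}"
    | "A - B \<noteq> {}" "A \<inter> B \<noteq> {}" "B - A \<noteq> {}"
    using AB by blast
  then show ?thesis
  proof cases
    case 1
    then have "two_cliques A B i j" if "i < n" "j < n" for i j
      using that by (auto simp: two_cliques_def)
    then have "\<exists>M. realizes (two_cliques A B) n ({#a, b#} + ({#a, b#} + \<Lambda>')) M"
      using ab n \<Lambda>' by (intro realizes_complete) auto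
    then show ?thesis
      by (simp add: \<Lambda>' add_mset_commute)
  next
    case 2
    have fin: "finite A" "finite B"
      using AB by (metis finite_Un finite_lessThan)+
    have "card A + card B = n"
      using AB 2 fin by (metis card_Un_disjoint card_lessThan)
    \<comment> \<open>The two repeated values force \<open>n\<close> to be at least 4, so one clique
      has two vertices; by symmetry it may play the role of \<open>B\<close>.\<close>
    then consider "2 \<le> card B" | "2 \<le> card A"
      using n \<Lambda>' by fastforce
    then show ?thesis
    proof cases
      case 1
      then show ?thesis
        using realizes_disjoint_cliques[OF AB 2(1,2) _ ab(1), of \<Lambda>'] n \<Lambda>' by simp
    next
      case 2
      have "two_cliques B A = two_cliques A B"
        by (auto simp: two_cliques_def fun_eq_iff)
      then show ?thesis
        using realizes_disjoint_cliques[of B A n a b \<Lambda>'] AB 2 \<open>A \<inter> B = {}\<close> \<open>B \<noteq> {}\<close> ab n \<Lambda>'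
        by (simp add: ac_simps)
    qed
  next
    case 3
    define xs where "xs = sorted_list_of_set (set_mset \<Lambda>)"
    have xs: "3 \<le> length xs" "sorted_wrt (<) xs" "set xs = set_mset \<Lambda>"
      using three by (simp_all add: xs_def)
    define x y z where xyz_def: "x = xs ! 0" "y = xs ! 1" "z = xs ! 2"
    have xyz: "x < y" "y < z"
      using xs(1) sorted_wrt_nth_less[OF xs(2), of 0 1] sorted_wrt_nth_less[OF xs(2), of 1 2]
      by (simp_all add: xyz_def)
    have "x \<in># \<Lambda>" "y \<in># \<Lambda>" "z \<in># \<Lambda>"
      using xs(1) unfolding xyz_def xs(3)[symmetric] by - (intro nth_mem; linarith)+
    then have "{#x, y, z#} \<subseteq># \<Lambda>"
      using xyz by (auto simp: subseteq_mset_def Suc_le_eq)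
    then obtain \<Lambda>'' where "\<Lambda> = {#x, y, z#} + \<Lambda>''"
      by (metis subset_mset.add_diff_inverse)
    then show ?thesis
      using realizes_overlapping_cliques[OF AB 3 xyz, of \<Lambda>''] n by simp
  qed
qed

section \<open>The graph G(K_{n-k}) as a union of two cliques\<close>

text \<open>A clique and an independent set share at most one vertex. If \<open>K\<close> and
  \<open>C\<close> are disjoint, they cover the graph and the cliques are \<open>K\<close> and
  \<open>S \<union> C\<close>. Otherwise they miss one vertex \<open>w\<close>, and the cliques are
  \<open>K \<union> C\<close> and \<open>w\<close> with its neighbours.\<close>

lemma add_complete_graph_two_cliques:
  assumes G: "pair_graph G"
    and K: "clique G K" and C: "cluster G C S" and card: "card K + card C = card (pverts G)"
    and H: "complete_digraph (card C) (with_proj H)" "bij_betw f (pverts H) C"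
  obtains A B where "A \<union> B = pverts G"
    and "\<And>i j. i \<in> pverts G \<Longrightarrow> j \<in> pverts G \<Longrightarrow> i \<noteq> j \<Longrightarrow>
      (i, j) \<in> parcs (add_graph G H f) \<longleftrightarrow> two_cliques A B i j"
proof -
  interpret pair_graph G by fact
  let ?E = "parcs (add_graph G H f)"
  have sym: "(i, j) \<in> parcs G \<longleftrightarrow> (j, i) \<in> parcs G" for i j
    using arcs_symmetric by blast
  have CV: "C \<subseteq> pverts G" and ind: "\<And>u v. u \<in> C \<Longrightarrow> v \<in> C \<Longrightarrow> (u, v) \<notin> parcs G"
    and nb: "\<And>u v. v \<in> C \<Longrightarrow> (v, u) \<in> parcs G \<longleftrightarrow> u \<in> S" and SV: "S \<subseteq> pverts G"
    using C in_arcsD2 by (fastforce simp: cluster_def independent_twins_def nbhd_def)+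
  have KV: "K \<subseteq> pverts G" and Kad: "\<And>u v. u \<in> K \<Longrightarrow> v \<in> K \<Longrightarrow> u \<noteq> v \<Longrightarrow> (u, v) \<in> parcs G"
    using K by (auto simp: clique_def)
  have fin: "finite K" "finite C"
    using KV CV pair_finite_verts finite_subset by blast+
  have "parcs H = {(u, v). u \<in> pverts H \<and> v \<in> pverts H \<and> u \<noteq> v}"
    using H(1) by (auto simp: complete_digraph_pair_def)
  then have E: "(i, j) \<in> ?E \<longleftrightarrow> (i, j) \<in> parcs G \<or> i \<in> C \<and> j \<in> C" if "i \<noteq> j" for i j
    using that H(2) by (auto simp: add_graph_def bij_betw_def inj_on_def image_iff)
  have SC: "S \<inter> C = {}"
    using ind nb by blast
  show ?thesis
  proof (cases "K \<inter> C = {}")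
    case True
    then have "card (K \<union> C) = card (pverts G)"
      using card fin by (simp add: card_Un_disjoint)
    then have V: "K \<union> C = pverts G"
      using KV CV pair_finite_verts by (intro card_subset_eq) auto
    show ?thesis
    proof
      show "K \<union> (S \<union> C) = pverts G"
        using V SV by auto
      show "(i, j) \<in> ?E \<longleftrightarrow> two_cliques K (S \<union> C) i j"
        if "i \<in> pverts G" "j \<in> pverts G" "i \<noteq> j" for i j
      proof -
        \<comment> \<open>As \<open>S\<close> avoids \<open>C\<close>, it lies in the clique
          \<open>K\<close>; hence \<open>S \<union> C\<close> is complete once \<open>C\<close>
          is.\<close>
        have "i \<in> K \<longleftrightarrow> i \<notin> C" "j \<in> K \<longleftrightarrow> j \<notin> C" "S \<subseteq> K"
          using that V True SC SV by auto
        then show ?thesis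
          unfolding E[OF that(3)] two_cliques_def
          using Kad[of i j] nb[of i j] nb[of j i] sym[of i j] that(3) by auto
      qed
    qed
  next
    case False
    then obtain c where c: "c \<in> K" "c \<in> C" by blast
    then have KC: "K \<inter> C = {c}"
      using Kad ind by blast
    then have "card (pverts G - (K \<union> C)) = 1"
      using card card_Un_Int[OF fin] card_Diff_subset[of "K \<union> C" "pverts G"] KV CV fin by auto
    then obtain w where w: "pverts G - (K \<union> C) = {w}"
      by (auto simp: card_1_singleton_iff)
    \<comment> \<open>Such a vertex is adjacent to \<open>c\<close>, so it lies in \<open>S\<close>
      and is adjacent to all of \<open>C\<close>. This makes \<open>K \<union> C\<close>
      complete.\<close>
    have KS: "i \<in> S" if "i \<in> K" "i \<notin> C" for i
      using that c Kad nb by metis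
    define A where "A = K \<union> C"
    have A: "i \<in> pverts G \<Longrightarrow> i \<in> A \<or> i = w" "w \<notin> A" "w \<in> pverts G" "w \<notin> C" for i
      using w by (auto simp: A_def)
    have Aad: "(i, j) \<in> parcs G \<or> i \<in> C \<and> j \<in> C" if "i \<in> A" "j \<in> A" "i \<noteq> j" for i j
      using that KS Kad nb sym unfolding A_def by blast
    show ?thesis
    proof
      \<comment> \<open>All neighbours of \<open>w\<close> lie in \<open>A\<close>, so the second
        clique contributes exactly the edges at \<open>w\<close>, which are unchanged because
        \<open>w\<close> is outside \<open>C\<close>.\<close>
      show "A \<union> insert w (nbhd G w) = pverts G"
        using w KV CV by (auto simp: A_def nbhd_def)
      show "(i, j) \<in> ?E \<longleftrightarrow> two_cliques A (insert w (nbhd G w)) i j"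
        if "i \<in> pverts G" "j \<in> pverts G" "i \<noteq> j" for i j
        unfolding E[OF that(3)] two_cliques_def nbhd_def
        using that A Aad[of i j] sym[of i j] by (cases "i = w"; cases "j = w") auto
    qed
  qed
qed

theorem theorem3p3:
  fixes G :: "nat pair_pre_digraph" and H :: "'b pair_pre_digraph"
    and n k r :: nat and K C S :: "nat set" and f :: "'b \<Rightarrow> nat"
    and \<Lambda> :: "real multiset"
  assumes "pair_graph G" and "pverts G = {0..<n}"
    and "clique G K" and "card K = k"
    and "cluster G C S" and "card C = n - k" and "card S = r" and "r \<le> k"
    and "complete_digraph (n - k) (with_proj H)" and "bij_betw f (pverts H) C"
    and "size \<Lambda> = n"
    and "3 \<le> card (set_mset \<Lambda>)"
    and "2 \<le> card {x \<in> set_mset \<Lambda>. 2 \<le> count \<Lambda> x}"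
  shows "\<exists>M \<in> sym_mats (add_graph G H f). eigenvalue_mset M = \<Lambda>"
proof -
  \<comment> \<open>Ensures that the natural number subtraction \<open>n - k\<close> is not
    truncated.\<close>
  have "k \<le> n"
    using assms(2-4) card_mono[of "{0..<n}" K] by (auto simp: clique_def)
  then have "card K + card C = card (pverts G)"
    using assms(2,4,6) by simp
  then obtain A B where AB: "A \<union> B = pverts G"
    and E: "\<And>i j. i \<in> pverts G \<Longrightarrow> j \<in> pverts G \<Longrightarrow> i \<noteq> j \<Longrightarrow>
      (i, j) \<in> parcs (add_graph G H f) \<longleftrightarrow> two_cliques A B i j"
    using add_complete_graph_two_cliques[of G K C S H f] assms(1,3,5,6,9,10) by metis
  obtain M where M: "realizes (two_cliques A B) n \<Lambda> M"
    using realizes_two_cliques[of A B n \<Lambda>] AB assms(2,11-13) by (auto simp: atLeast0LessThan)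
  then have "M \<in> sym_mats (add_graph G H f)"
    using E assms(2) by (auto simp: sym_mats_def realizes_def add_graph_def)
  then show ?thesis
    using eigenvalue_mset_realizes[OF M] by blast
qed

end
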